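(* Let $W$ be a finite Coxeter group and let $\Phi^+(W)$ be its set of positive roots. The maximal number of colors used in a transitive coloring of $\Phi^+(W)$ is equal to the rank of $W$.
   Context: The rank of a Coxeter group is its number of Coxeter (simple) generators; $\Phi^+(W)$ is the set of positive roots of the root system of $W$, viewed as a finite set of vectors in the real geometric representation. A transitive coloring of a finite set $E$ of vectors in a real vector space is a function $\varepsilon$ from $E$ to a set of colors such that for any two disjoint (nonempty) subsets $S,T\subseteq E$: if $\operatorname{span}_{\mathbb{R}_{>0}}(S)\cap\operatorname{span}_{\mathbb{R}_{>0}}(T)\neq\varnothing$ then $\varepsilon(S)\cap\varepsilon(T)\neq\varnothing$, where $\operatorname{span}_{\mathbb{R}_{>0}}(S)$ is the set of linear combinations of all elements of $S$ with strictly positive coefficients. Equivalently, it is a coloring such that for every signed circuit $(X^+,X^-)$ of the oriented matroid of linear dependencies of $E$, $\varepsilon(X^+)\cap\varepsilon(X^-)\neq\varnothing$. The number of colors used is $|\varepsilon(E)|$. *)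

theory Defs
  imports
    "HOL-Algebra.Multiplicative_Group"
    "HOL-Algebra.Generated_Groups"
    "HOL-Analysis.Finite_Function_Topology"
begin

section \<open>Coxeter systems\<close>

text \<open>The value 0 encodes infinite order, as for \<^const>\<open>group.ord\<close>.\<close>

definition coxeter_entry :: "('a, 'b) monoid_scheme \<Rightarrow> 'a \<Rightarrow> 'a \<Rightarrow> nat" where
  "coxeter_entry G s t = group.ord G (s \<otimes>\<^bsub>G\<^esub> t)"

text \<open>
  One insertion of a relator \<open>(s t)\<^sup>m\<close>, where \<open>m\<close> is the order of \<open>s t\<close>, into a word over \<open>S\<close>.
  No relator arises from a product of infinite order, since the inserted word is then empty.
  The case \<open>s = t\<close> is the relator \<open>s s\<close>, so formal inverses of the letters are not needed.
\<close>

inductive coxeter_step :: "('a, 'b) monoid_scheme \<Rightarrow> 'a set \<Rightarrow> 'a list \<Rightarrow> 'a list \<Rightarrow> bool"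
  for G (structure) and S where
  "\<lbrakk>u \<in> lists S; v \<in> lists S; s \<in> S; t \<in> S\<rbrakk>
    \<Longrightarrow> coxeter_step G S (u @ v) (u @ concat (replicate (coxeter_entry G s t) [s, t]) @ v)"

definition word_prod :: "('a, 'b) monoid_scheme \<Rightarrow> 'a list \<Rightarrow> 'a" where
  "word_prod G ws = foldr (\<lambda>s x. s \<otimes>\<^bsub>G\<^esub> x) ws \<one>\<^bsub>G\<^esub>"

text \<open>
  \<open>(G, S)\<close> is a Coxeter system: \<open>S\<close> is a generating set of involutions, and
  \<open>\<langle>S | (s t)\<^sup>m\<^sup>(\<^sup>s\<^sup>,\<^sup>t\<^sup>) = 1\<rangle>\<close> is a presentation of \<open>G\<close>, that is, two words have the same product
  iff the relators transform one into the other. The rank of the system is \<open>card S\<close>.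
\<close>

locale coxeter_system = group G for G :: "('a, 'b) monoid_scheme" (structure) +
  fixes S :: "'a set"
  assumes simple_in_carrier: "S \<subseteq> carrier G"
    and generated: "generate G S = carrier G"
    and involution: "s \<in> S \<Longrightarrow> ord s = 2"
    and presentation: "\<lbrakk>u \<in> lists S; v \<in> lists S\<rbrakk>
      \<Longrightarrow> word_prod G u = word_prod G v \<longleftrightarrow> equivclp (coxeter_step G S) u v"


section \<open>Geometric representation and positive roots\<close>

text \<open>
  The geometric representation lives on the real vector space with basis \<open>S\<close>, which we realise as
  the space of vectors of type \<open>'a \<Rightarrow>\<^sub>0 real\<close> with support in \<open>S\<close>.
\<close>

definition simple_root :: "'a \<Rightarrow> ('a \<Rightarrow>\<^sub>0 real)" where
  "simple_root s = Poly_Mapping.single s 1"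

definition coxeter_form :: "('a, 'b) monoid_scheme \<Rightarrow> ('a \<Rightarrow>\<^sub>0 real) \<Rightarrow> ('a \<Rightarrow>\<^sub>0 real) \<Rightarrow> real" where
  "coxeter_form G v w =
    (\<Sum>s\<in>Poly_Mapping.keys v. \<Sum>t\<in>Poly_Mapping.keys w.
      Poly_Mapping.lookup v s * Poly_Mapping.lookup w t *
      (if coxeter_entry G s t = 0 then - 1 else - cos (pi / real (coxeter_entry G s t))))"

definition simple_reflection ::
    "('a, 'b) monoid_scheme \<Rightarrow> 'a \<Rightarrow> ('a \<Rightarrow>\<^sub>0 real) \<Rightarrow> ('a \<Rightarrow>\<^sub>0 real)" where
  "simple_reflection G s v = v - (2 * coxeter_form G (simple_root s) v) *\<^sub>R simple_root s"

text \<open>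
  An element of \<open>G\<close> acts through any word in \<open>S\<close> that represents it, so the images of the simple
  roots under all words are their images under all elements of \<open>G\<close>.
\<close>

definition roots :: "('a, 'b) monoid_scheme \<Rightarrow> 'a set \<Rightarrow> ('a \<Rightarrow>\<^sub>0 real) set" where
  "roots G S = {foldr (simple_reflection G) ws (simple_root s) | ws s. ws \<in> lists S \<and> s \<in> S}"

definition positive_roots :: "('a, 'b) monoid_scheme \<Rightarrow> 'a set \<Rightarrow> ('a \<Rightarrow>\<^sub>0 real) set" where
  "positive_roots G S = {v \<in> roots G S. \<forall>s. 0 \<le> Poly_Mapping.lookup v s}"


section \<open>Transitive colorings\<close>

definition pos_span :: "'v::real_vector set \<Rightarrow> 'v set" where
  "pos_span A = {\<Sum>v\<in>A. c v *\<^sub>R v | c. \<forall>v\<in>A. 0 < c v}"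

text \<open>
  Intended for finite \<open>E\<close>, where finiteness of \<open>A\<close> and \<open>B\<close> is automatic; it is spelled out because
  \<^const>\<open>sum\<close> is 0 on infinite sets.
\<close>

definition transitive_coloring :: "'v::real_vector set \<Rightarrow> ('v \<Rightarrow> 'c) \<Rightarrow> bool" where
  "transitive_coloring E \<epsilon> \<longleftrightarrow>
    (\<forall>A B. A \<subseteq> E \<and> B \<subseteq> E \<and> finite A \<and> finite B \<and> A \<noteq> {} \<and> B \<noteq> {} \<and> A \<inter> B = {} \<and>
      pos_span A \<inter> pos_span B \<noteq> {} \<longrightarrow> \<epsilon> ` A \<inter> \<epsilon> ` B \<noteq> {})"

end

theory Submission
  imports Defs
begin

text \<open>
  Both bounds only use that the positive roots are nonzero vectors with nonnegative coordinates in
  a space of dimension \<open>card S\<close>.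

  Colour a positive root by the largest simple root in its support, for some total order on \<open>S\<close>.
  There is no cancellation in a positive combination, so its support is the union of the supports
  of the summands. The largest element of the support of a common element of two positive spans is
  hence a colour on both sides.

  Conversely, choose one root of each colour. A linear dependency among these roots has coefficients
  of both signs, and moving the negative part to the other side gives disjoint sets of roots whose
  positive spans meet although they have no colour in common. So the chosen roots are linearly
  independent.
\<close>

lemma lookup_scaleR [simp]:
  "Poly_Mapping.lookup (r *\<^sub>R v) x = r *\<^sub>R Poly_Mapping.lookup v x"
proof -
  have "finite {i. r *\<^sub>R Poly_Mapping.lookup v i \<noteq> 0}"
    by (rule finite_subset[OF _ finite_lookup[of v]]) auto
  then show ?thesis
    by (simp add: scaleR_poly_mapping_def)
qed

text \<open>Nonnegative coordinates cannot cancel. The upper bound uses this too, to see that a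
  linear dependency has coefficients of both signs.\<close>

lemma keys_pos_combination:
  fixes A :: "('a \<Rightarrow>\<^sub>0 real) set"
  assumes "finite A" and nonneg: "\<And>v x. v \<in> A \<Longrightarrow> 0 \<le> Poly_Mapping.lookup v x"
    and pos: "\<And>v. v \<in> A \<Longrightarrow> 0 < c v"
  shows "Poly_Mapping.keys (\<Sum>v\<in>A. c v *\<^sub>R v) = (\<Union>v\<in>A. Poly_Mapping.keys v)"
proof -
  have "(\<Sum>v\<in>A. c v * Poly_Mapping.lookup v x) = 0 \<longleftrightarrow> (\<forall>v\<in>A. Poly_Mapping.lookup v x = 0)" for x
  proof -
    have "(\<Sum>v\<in>A. c v * Poly_Mapping.lookup v x) = 0
        \<longleftrightarrow> (\<forall>v\<in>A. c v * Poly_Mapping.lookup v x = 0)"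
      using assms by (intro sum_nonneg_eq_0_iff) (simp_all add: less_imp_le)
    then show ?thesis
      using pos by force
  qed
  then show ?thesis
    by (auto simp: in_keys_iff lookup_sum)
qed

text \<open>The map \<open>f\<close> supplies the order on coordinates, since \<open>'a\<close>
  carries none.\<close>

lemma Max_image_keys_transitive_coloring:
  fixes E :: "('a \<Rightarrow>\<^sub>0 real) set" and f :: "'a \<Rightarrow> 'c::linorder"
  assumes nonneg: "\<And>v x. v \<in> E \<Longrightarrow> 0 \<le> Poly_Mapping.lookup v x" and nz: "0 \<notin> E"
  shows "transitive_coloring E (\<lambda>v. Max (f ` Poly_Mapping.keys v))"
  unfolding transitive_coloring_def
proof (intro allI impI, elim conjE)
  fix A B
  assume sub: "A \<subseteq> E" "B \<subseteq> E" and fin: "finite A" "finite B" and ne: "A \<noteq> {}" "B \<noteq> {}"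
    and "pos_span A \<inter> pos_span B \<noteq> {}"
  then obtain x where x: "x \<in> pos_span A" "x \<in> pos_span B"
    by blast
  \<comment> \<open>The shared colour is read off from \<open>x\<close> itself, which may lie
    outside \<open>E\<close>.\<close>
  have attained: "Max (f ` Poly_Mapping.keys x) \<in> (\<lambda>v. Max (f ` Poly_Mapping.keys v)) ` D"
    if D: "D \<subseteq> E" "finite D" "D \<noteq> {}" "x \<in> pos_span D" for D
  proof -
    obtain c where "x = (\<Sum>v\<in>D. c v *\<^sub>R v)" "\<forall>v\<in>D. 0 < c v"
      using D(4) unfolding pos_span_def by blast
    then have keys: "Poly_Mapping.keys x = (\<Union>v\<in>D. Poly_Mapping.keys v)"
      using D nonneg by (simp add: keys_pos_combination subset_iff)
    \<comment> \<open>Members of \<open>D\<close> are nonzero, so \<open>Max\<close> is taken over a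
      nonempty set.\<close>
    have "Poly_Mapping.keys x \<noteq> {}"
      using D nz keys by force
    then have "Max (f ` Poly_Mapping.keys x) \<in> f ` Poly_Mapping.keys x"
      by (intro Max_in) auto
    then obtain v where v: "v \<in> D" "Max (f ` Poly_Mapping.keys x) \<in> f ` Poly_Mapping.keys v"
      using keys by auto
    have "y \<le> Max (f ` Poly_Mapping.keys x)" if "y \<in> f ` Poly_Mapping.keys v" for y
    proof (rule Max_ge)
      show "y \<in> f ` Poly_Mapping.keys x"
        using v(1) keys that by auto
    qed simp
    then have "Max (f ` Poly_Mapping.keys v) = Max (f ` Poly_Mapping.keys x)"
      using v(2) by (intro Max_eqI) auto
    then show ?thesis
      using v(1) by (metis image_eqI)
  qed
  show "(\<lambda>v. Max (f ` Poly_Mapping.keys v)) ` A \<inter> (\<lambda>v. Max (f ` Poly_Mapping.keys v)) ` B \<noteq> {}"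
    using attained[of A] attained[of B] sub fin ne x by blast
qed

lemma transitive_coloring_inj_on_independent:
  fixes E :: "('a \<Rightarrow>\<^sub>0 real) set"
  assumes col: "transitive_coloring E \<epsilon>"
    and nonneg: "\<And>v x. v \<in> E \<Longrightarrow> 0 \<le> Poly_Mapping.lookup v x" and nz: "0 \<notin> E"
    and R: "R \<subseteq> E" "inj_on \<epsilon> R"
  shows "independent R"
proof
  assume "dependent R"
  then obtain T u where T: "finite T" "T \<subseteq> R" and sum0: "(\<Sum>v\<in>T. u v *\<^sub>R v) = 0"
    and nontriv: "\<exists>v\<in>T. u v \<noteq> 0"
    unfolding dependent_explicit by blast
  define A where "A = {v \<in> T. 0 < u v}"
  define B where "B = {v \<in> T. u v < 0}"
  have fin: "finite A" "finite B" and sub: "A \<subseteq> E" "B \<subseteq> E"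
    using T R by (auto simp: A_def B_def)
  have "(\<Sum>v\<in>T. u v *\<^sub>R v) = (\<Sum>v\<in>A \<union> B. u v *\<^sub>R v)"
    using T by (intro sum.mono_neutral_right) (auto simp: A_def B_def)
  also have "\<dots> = (\<Sum>v\<in>A. u v *\<^sub>R v) + (\<Sum>v\<in>B. u v *\<^sub>R v)"
    using fin by (intro sum.union_disjoint) (auto simp: A_def B_def)
  finally have eq: "(\<Sum>v\<in>A. u v *\<^sub>R v) = (\<Sum>v\<in>B. (- u v) *\<^sub>R v)"
    using sum0 by (simp add: sum_negf eq_neg_iff_add_eq_0)
  have "Poly_Mapping.keys (\<Sum>v\<in>A. u v *\<^sub>R v) = (\<Union>v\<in>A. Poly_Mapping.keys v)"
    using fin sub nonneg by (intro keys_pos_combination) (auto simp: A_def)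
  moreover have "Poly_Mapping.keys (\<Sum>v\<in>B. (- u v) *\<^sub>R v) = (\<Union>v\<in>B. Poly_Mapping.keys v)"
    using fin sub nonneg by (intro keys_pos_combination) (auto simp: B_def)
  ultimately have keys: "(\<Union>v\<in>A. Poly_Mapping.keys v) = (\<Union>v\<in>B. Poly_Mapping.keys v)"
    using eq by simp
  \<comment> \<open>Nonzero vectors have nonempty support. As the two unions of supports agree,
    \<open>A\<close> and \<open>B\<close> are empty together, and nontriviality excludes
    that.\<close>
  have empty: "D = {}" if "D \<subseteq> E" "(\<Union>v\<in>D. Poly_Mapping.keys v) = {}" for D
    using that nz by force
  have "A \<noteq> {} \<or> B \<noteq> {}"
    using nontriv linorder_neq_iff unfolding A_def B_def by blast
  then have ne: "A \<noteq> {}" "B \<noteq> {}"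
    using keys empty[OF sub(1)] empty[OF sub(2)] by auto
  have "(\<Sum>v\<in>A. u v *\<^sub>R v) \<in> pos_span A"
    unfolding pos_span_def A_def by blast
  moreover have "(\<Sum>v\<in>B. (- u v) *\<^sub>R v) \<in> pos_span B"
    unfolding pos_span_def by (auto simp: B_def intro!: exI[of _ "\<lambda>v. - u v"])
  ultimately have "pos_span A \<inter> pos_span B \<noteq> {}"
    using eq by auto
  moreover have "A \<inter> B = {}"
    by (auto simp: A_def B_def)
  ultimately have "\<epsilon> ` A \<inter> \<epsilon> ` B \<noteq> {}"
    using col fin sub ne unfolding transitive_coloring_def by blast
  \<comment> \<open>By injectivity of \<open>\<epsilon>\<close> on \<open>R\<close>, a common colour
    would come from a vector in both \<open>A\<close> and \<open>B\<close>.\<close>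
  then show False
    using R(2) T(2) \<open>A \<inter> B = {}\<close> by (auto simp: A_def B_def inj_on_def)
qed

lemma keys_simple_root [simp]: "Poly_Mapping.keys (simple_root s) = {s}"
  by (simp add: simple_root_def)

context coxeter_system
begin

lemma coxeter_entry_self:
  assumes "s \<in> S"
  shows "coxeter_entry G s s = 1"
proof -
  have s: "s \<in> carrier G"
    using assms simple_in_carrier by auto
  then have "s [^] (2::nat) = \<one>"
    using involution[OF assms] pow_ord_eq_1[OF s] by simp
  then have "s \<otimes> s = \<one>"
    using s by (simp add: numeral_2_eq_2)
  then show ?thesis
    by (simp add: coxeter_entry_def)
qed

text \<open>The diagonal entry is 1 and \<open>- cos pi = 1\<close>, so simple roots are unit
  vectors for the form. The case \<open>a = 0\<close> is separate because the support is then
  empty.\<close>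

lemma coxeter_form_simple_root_scale:
  assumes "s \<in> S"
  shows "coxeter_form G (simple_root s) (a *\<^sub>R simple_root s) = a"
proof (cases "a = 0")
  case False
  then have "Poly_Mapping.keys (a *\<^sub>R simple_root s) = {s}"
    by (auto simp: in_keys_iff simple_root_def lookup_single when_def split: if_splits)
  then show ?thesis
    using coxeter_entry_self[OF assms] by (simp add: coxeter_form_def simple_root_def)
qed (simp add: coxeter_form_def)

text \<open>A vector in the kernel is \<open>2 * a\<close> times the simple root, where
  \<open>a\<close> is its form value against that root. Evaluating the form gives
  \<open>a = 2 * a\<close>.\<close>

lemma simple_reflection_eq_0_imp:
  assumes "s \<in> S" and "simple_reflection G s v = 0"
  shows "v = 0"
proof -
  define a where "a = coxeter_form G (simple_root s) v"
  have v: "v = (2 * a) *\<^sub>R simple_root s"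
    using assms(2) by (simp add: simple_reflection_def a_def)
  have "a = coxeter_form G (simple_root s) ((2 * a) *\<^sub>R simple_root s)"
    using a_def v by metis
  then have "a = 0"
    using assms(1) by (simp add: coxeter_form_simple_root_scale)
  with v show ?thesis
    by simp
qed

lemma zero_not_in_roots: "0 \<notin> roots G S"
proof -
  have "foldr (simple_reflection G) ws (simple_root s) \<noteq> 0" if "ws \<in> lists S" for ws s
    using that
  proof (induction ws)
    case Nil
    show ?case
      using keys_simple_root[of s] by (metis foldr_Nil id_apply insert_not_empty keys_zero)
  qed (use simple_reflection_eq_0_imp in auto)
  then show ?thesis
    by (force simp: roots_def)
qed

lemma roots_subset_span: "roots G S \<subseteq> span (simple_root ` S)"
proof -
  have "foldr (simple_reflection G) ws (simple_root s) \<in> span (simple_root ` S)"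
    if "ws \<in> lists S" "s \<in> S" for ws s
    using that
    by (induction ws) (auto simp: simple_reflection_def intro: span_diff span_scale span_base)
  then show ?thesis
    by (auto simp: roots_def)
qed

lemma simple_root_in_positive_roots: "s \<in> S \<Longrightarrow> simple_root s \<in> positive_roots G S"
  unfolding positive_roots_def roots_def
  by (auto simp: simple_root_def lookup_single when_def intro!: exI[of _ "[]"])

end

lemma keys_span_simple_roots:
  assumes "v \<in> span (simple_root ` S)"
  shows "Poly_Mapping.keys v \<subseteq> S"
  using assms
proof (induction rule: span_induct_alt)
  case (step c x y)
  then show ?case
    by (auto simp: in_keys_iff lookup_add simple_root_def lookup_single when_def split: if_splits)
qed simp

text \<open>Colours in \<open>nat\<close> attain the bound, which holds for colours of any type.
  Finiteness is stated explicitly because \<open>card\<close> is 0 on infinite sets.\<close>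

theorem corollary1p12:
  fixes G :: "('a, 'b) monoid_scheme" and S :: "'a set"
  assumes "coxeter_system G S" and "finite (carrier G)"
  shows "(\<exists>\<epsilon> :: ('a \<Rightarrow>\<^sub>0 real) \<Rightarrow> nat.
            transitive_coloring (positive_roots G S) \<epsilon> \<and>
            card (\<epsilon> ` positive_roots G S) = card S) \<and>
         (\<forall>\<epsilon> :: ('a \<Rightarrow>\<^sub>0 real) \<Rightarrow> 'c.
            transitive_coloring (positive_roots G S) \<epsilon> \<longrightarrow>
            finite (\<epsilon> ` positive_roots G S) \<and> card (\<epsilon> ` positive_roots G S) \<le> card S)"
proof -
  interpret coxeter_system G S
    by fact
  let ?P = "positive_roots G S"
  have finS: "finite S"
    using simple_in_carrier assms(2) finite_subset by blast
  have nonneg: "\<And>v x. v \<in> ?P \<Longrightarrow> 0 \<le> Poly_Mapping.lookup v x"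
    and nz: "0 \<notin> ?P" and span: "?P \<subseteq> span (simple_root ` S)"
    using zero_not_in_roots roots_subset_span by (auto simp: positive_roots_def)
  show ?thesis
  proof (intro conjI allI impI)
    \<comment> \<open>Numbering the generators gives the total order on \<open>S\<close>;
      injectivity yields \<open>card S\<close> distinct colours.\<close>
    obtain f :: "'a \<Rightarrow> nat" where f: "inj_on f S"
      using finite_imp_inj_to_nat_seg[OF finS] by blast
    let ?col = "\<lambda>v. Max (f ` Poly_Mapping.keys v)"
    have "?col v \<in> f ` S" if "v \<in> ?P" for v
    proof -
      have "v \<noteq> 0"
        using that nz by auto
      then have "?col v \<in> f ` Poly_Mapping.keys v"
        by (intro Max_in) auto
      then show ?thesis
        using keys_span_simple_roots[of v S] that span by blast
    qed
    \<comment> \<open>The support of a simple root is a singleton, so each number occurs as its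
      colour.\<close>
    moreover have "f s \<in> ?col ` ?P" if "s \<in> S" for s
      using simple_root_in_positive_roots[OF that] by (force intro: rev_image_eqI)
    ultimately have "?col ` ?P = f ` S"
      by blast
    then have "card (?col ` ?P) = card S"
      using f by (simp add: card_image)
    then show "\<exists>\<epsilon> :: ('a \<Rightarrow>\<^sub>0 real) \<Rightarrow> nat. transitive_coloring ?P \<epsilon> \<and> card (\<epsilon> ` ?P) = card S"
      using Max_image_keys_transitive_coloring[OF nonneg nz] by blast
  next
    fix \<epsilon> :: "('a \<Rightarrow>\<^sub>0 real) \<Rightarrow> 'c"
    assume col: "transitive_coloring ?P \<epsilon>"
    \<comment> \<open>\<open>R\<close> picks one root of each colour.\<close>
    obtain R where R: "R \<subseteq> ?P" "inj_on \<epsilon> R" "\<epsilon> ` ?P = \<epsilon> ` R"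
      by (metis subset_image_inj subset_refl)
    have "independent R"
      using transitive_coloring_inj_on_independent[OF col nonneg nz R(1,2)] .
    \<comment> \<open>The dimension bound also gives finiteness of \<open>R\<close>, hence of the
      set of colours.\<close>
    then have "finite R \<and> card R \<le> card (simple_root ` S)"
      using independent_span_bound[of "simple_root ` S" R] finS R(1) span by auto
    moreover have "card (simple_root ` S) \<le> card S"
      using finS by (rule card_image_le)
    ultimately show "finite (\<epsilon> ` ?P)" and "card (\<epsilon> ` ?P) \<le> card S"
      using R(2,3) by (auto simp: card_image)
  qed
qed

end
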